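(* Let $T,T'$ be two towers all of whose levels are nonempty, with levels $X_n=lev_T^{-1}(n)$, $Y_n=lev_{T'}^{-1}(n)$ and corresponding $D_+$-chains $(X_n,\Phi_n)$, $(Y_n,\Psi_n)$. Let $(Z_n,\mathcal V_n)$ be a common zig-zag $D_+$-chain of $(X_n,\Phi_n)$ and $(Y_n,\Psi_n)$, with increasing maps $\alpha,\beta\colon\mathbb N\to\mathbb N$ such that $Z_{2n-1}=X_{\alpha(n)}$ and $Z_{2n}=Y_{\beta(n)}$. Let $f_Z\colon T(\alpha)\to T'(\beta)$ be the map whose restriction to the $n$-th level $X_{\alpha(n)}$ of $T(\alpha)$ is $\mathcal V_{2n-1}\colon X_{\alpha(n)}\to Y_{\beta(n)}$, for every $n$. Then $f_Z$ is an admissible morphism.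
   Context: $\mathbb N=\{1,2,\dots\}$; increasing means strictly increasing. In a partially ordered set, $\downarrow x=\{y:y\le x\}$, $\uparrow x=\{y:y\ge x\}$; a subset $A$ is a lower set if $\downarrow a\subset A$ for all $a\in A$. Tower: a partially ordered set $T$ such that (1) $T$ is well-founded (every nonempty subset has a minimal element); (2) any two elements $x,y$ have a smallest upper bound; (3) every $\uparrow x$ is linearly ordered; (4) for every $a\in T$ there is a finite number $lev_T(a)$ such that $|\uparrow x\cap\downarrow a|=lev_T(a)$ for every minimal element $x\in\downarrow a$ of $T$. The levels are $L_i=lev_T^{-1}(i)$. For $x\in T$, $pred(x)=L_{lev_T(x)-1}\cap\downarrow x$. For increasing $\alpha\colon\mathbb N\to\mathbb N$, $T(\alpha)=\bigcup_nL_{\alpha(n)}$ with the induced order; its $n$-th level is $L_{\alpha(n)}$. $D_+$-chain: sets $X_n$ ($n\in\mathbb N$) and surjective maps $\Phi_n\colon X_n\to X_{n+1}$ with trivial (one-point) direct limit. The $D_+$-chain of a tower $T$ consists of its levels $L_i$ and the maps $L_i\to L_{i+1}$ sending $x_i$ to the unique $x_{i+1}\in L_{i+1}$ with $x_i\le x_{i+1}$. The $\alpha$-subchain of $(X_n,\Phi_n)$ is $(X_{\alpha(n)},\tilde\Phi_n)$, $\tilde\Phi_n=\Phi_{\alpha(n+1)-1}\circ\cdots\circ\Phi_{\alpha(n)}$. Common zig-zag $D_+$-chain of $(X_n,\Phi_n)$, $(Y_n,\Psi_n)$: a $D_+$-chain $(Z_n,\mathcal V_n)$ with increasing $\alpha,\beta\colon\mathbb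 N\to\mathbb N$ such that $Z_{2n-1}=X_{\alpha(n)}$, $Z_{2n}=Y_{\beta(n)}$ for all $n$ (so $\mathcal V_{2n-1}\colon X_{\alpha(n)}\to Y_{\beta(n)}$, $\mathcal V_{2n}\colon Y_{\beta(n)}\to X_{\alpha(n+1)}$), and $\mathcal V_{2n}\circ\mathcal V_{2n-1}=\tilde\Phi_n$, $\mathcal V_{2n+1}\circ\mathcal V_{2n}=\tilde\Psi_n$ for all $n$. Admissible morphism: a map $\phi\colon A\to T_2$ defined on a lower subset $A$ of a tower $T_1$, with $T_2$ a tower, such that (1) $lev(\phi(a))=lev(a)$ for all $a\in A$; (2) $a\le a'$ in $A$ implies $\phi(a)\le\phi(a')$; (3) $\phi(a)=\phi(a')$ with $a,a'\in A$ implies $a,a'\in pred(v)$ for some $v\in T_1$; (4) $\phi(A)$ is a lower subset of $T_2$; (5) $|\phi(\max A)|\le1$, where $\max A$ is the (possibly empty) set of maximal elements of $A$. Here this is applied with $A=T_1=T(\alpha)$ and $T_2=T'(\beta)$, levels and pred being those of the towers $T(\alpha)$, $T'(\beta)$. *)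

theory Defs
  imports Main
begin

text \<open>
  A partially ordered set is given by its order relation \<open>r\<close>; its carrier is \<open>Field r\<close>.
  The principal lower and upper sets of \<open>x\<close> are \<open>under r x\<close> and \<open>above r x\<close>, and the
  order induced on \<open>S\<close> is \<open>Restr r S\<close>.
  The natural numbers of the mathematical text start at 1, so sequences are
  functions on \<open>nat\<close> whose value at 0 is irrelevant.
\<close>

definition min_elems :: "'a rel \<Rightarrow> 'a set \<Rightarrow> 'a set" where
  "min_elems r S = {x \<in> S. \<forall>y\<in>S. (y, x) \<in> r \<longrightarrow> y = x}"

definition max_elems :: "'a rel \<Rightarrow> 'a set \<Rightarrow> 'a set" where
  "max_elems r S = {x \<in> S. \<forall>y\<in>S. (x, y) \<in> r \<longrightarrow> y = x}"

definition lower_set :: "'a rel \<Rightarrow> 'a set \<Rightarrow> bool" where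
  "lower_set r A \<longleftrightarrow> A \<subseteq> Field r \<and> (\<forall>a\<in>A. under r a \<subseteq> A)"

definition tower :: "'a rel \<Rightarrow> bool" where
  "tower r \<longleftrightarrow>
     Partial_order r \<and>
     (\<forall>S. S \<subseteq> Field r \<and> S \<noteq> {} \<longrightarrow> min_elems r S \<noteq> {}) \<and>
     (\<forall>x\<in>Field r. \<forall>y\<in>Field r. \<exists>z. (x, z) \<in> r \<and> (y, z) \<in> r \<and>
        (\<forall>w. (x, w) \<in> r \<and> (y, w) \<in> r \<longrightarrow> (z, w) \<in> r)) \<and>
     (\<forall>x\<in>Field r. total_on (above r x) r) \<and>
     (\<forall>a\<in>Field r. \<exists>n. \<forall>x\<in>min_elems r (Field r) \<inter> under r a.
        finite (above r x \<inter> under r a) \<and> card (above r x \<inter> under r a) = n)"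

definition lev :: "'a rel \<Rightarrow> 'a \<Rightarrow> nat" where
  "lev r a = (THE n. \<forall>x\<in>min_elems r (Field r) \<inter> under r a.
     card (above r x \<inter> under r a) = n)"

definition level :: "'a rel \<Rightarrow> nat \<Rightarrow> 'a set" where
  "level r n = {a \<in> Field r. lev r a = n}"

text \<open>Levels of a tower are at least 1, so \<open>level r 0\<close>, and with it the \<open>tower_pred\<close> of an
  element of level 1, is empty.\<close>

definition tower_pred :: "'a rel \<Rightarrow> 'a \<Rightarrow> 'a set" where
  "tower_pred r x = level r (lev r x - 1) \<inter> under r x"

definition increasing :: "(nat \<Rightarrow> nat) \<Rightarrow> bool" where
  "increasing \<alpha> \<longleftrightarrow> (\<forall>n\<ge>1. \<alpha> n \<ge> 1) \<and> strict_mono_on {1..} \<alpha>"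

definition subtower :: "'a rel \<Rightarrow> (nat \<Rightarrow> nat) \<Rightarrow> 'a rel" where
  "subtower r \<alpha> = Restr r (\<Union>n\<in>{1..}. level r (\<alpha> n))"

text \<open>For \<open>m \<le> k\<close>, \<open>fold \<Phi> [m..<k]\<close> is the composite of \<open>\<Phi> m, \<dots>, \<Phi> (k - 1)\<close>, with
  \<open>\<Phi> m\<close> applied first.\<close>

definition direct_limit :: "(nat \<Rightarrow> 'a set) \<Rightarrow> (nat \<Rightarrow> 'a \<Rightarrow> 'a) \<Rightarrow> (nat \<times> 'a) set set" where
  "direct_limit X \<Phi> =
     (SIGMA n:{1..}. X n) //
     {((n, x), (m, y)). n \<ge> 1 \<and> x \<in> X n \<and> m \<ge> 1 \<and> y \<in> X m \<and>
        (\<exists>k. n \<le> k \<and> m \<le> k \<and> fold \<Phi> [n..<k] x = fold \<Phi> [m..<k] y)}"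

definition D_plus_chain :: "(nat \<Rightarrow> 'a set) \<Rightarrow> (nat \<Rightarrow> 'a \<Rightarrow> 'a) \<Rightarrow> bool" where
  "D_plus_chain X \<Phi> \<longleftrightarrow>
     (\<forall>n\<ge>1. \<Phi> n ` X n = X (n + 1)) \<and> is_singleton (direct_limit X \<Phi>)"

text \<open>The \<open>D\<^sub>+\<close>-chain of a tower \<open>r\<close> consists of \<open>level r\<close> and \<open>level_map r\<close>.\<close>

definition level_map :: "'a rel \<Rightarrow> nat \<Rightarrow> 'a \<Rightarrow> 'a" where
  "level_map r i x = (THE y. y \<in> level r (i + 1) \<and> (x, y) \<in> r)"

definition subchain_map :: "(nat \<Rightarrow> 'a \<Rightarrow> 'a) \<Rightarrow> (nat \<Rightarrow> nat) \<Rightarrow> nat \<Rightarrow> 'a \<Rightarrow> 'a" where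
  "subchain_map \<Phi> \<alpha> n = fold \<Phi> [\<alpha> n..<\<alpha> (n + 1)]"

text \<open>The sets \<open>X n\<close> and \<open>Y n\<close> may live in different types, so the zig-zag chain lives in
  their sum type, via the injections \<open>Inl\<close> and \<open>Inr\<close>.\<close>

definition zigzag_chain ::
  "(nat \<Rightarrow> 'a set) \<Rightarrow> (nat \<Rightarrow> 'a \<Rightarrow> 'a) \<Rightarrow> (nat \<Rightarrow> 'b set) \<Rightarrow> (nat \<Rightarrow> 'b \<Rightarrow> 'b) \<Rightarrow>
   (nat \<Rightarrow> ('a + 'b) set) \<Rightarrow> (nat \<Rightarrow> 'a + 'b \<Rightarrow> 'a + 'b) \<Rightarrow>
   (nat \<Rightarrow> nat) \<Rightarrow> (nat \<Rightarrow> nat) \<Rightarrow> bool" where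
  "zigzag_chain X \<Phi> Y \<Psi> Z V \<alpha> \<beta> \<longleftrightarrow>
     D_plus_chain Z V \<and> increasing \<alpha> \<and> increasing \<beta> \<and>
     (\<forall>n\<ge>1. Z (2 * n - 1) = Inl ` X (\<alpha> n)) \<and>
     (\<forall>n\<ge>1. Z (2 * n) = Inr ` Y (\<beta> n)) \<and>
     (\<forall>n\<ge>1. \<forall>x\<in>X (\<alpha> n). V (2 * n) (V (2 * n - 1) (Inl x)) = Inl (subchain_map \<Phi> \<alpha> n x)) \<and>
     (\<forall>n\<ge>1. \<forall>y\<in>Y (\<beta> n). V (2 * n + 1) (V (2 * n) (Inr y)) = Inr (subchain_map \<Psi> \<beta> n y))"

text \<open>Values of \<open>\<phi>\<close> outside \<open>A\<close> are irrelevant.\<close>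

definition admissible_morphism :: "'a rel \<Rightarrow> 'a set \<Rightarrow> 'b rel \<Rightarrow> ('a \<Rightarrow> 'b) \<Rightarrow> bool" where
  "admissible_morphism r1 A r2 \<phi> \<longleftrightarrow>
     tower r1 \<and> tower r2 \<and> lower_set r1 A \<and> \<phi> ` A \<subseteq> Field r2 \<and>
     (\<forall>a\<in>A. lev r2 (\<phi> a) = lev r1 a) \<and>
     (\<forall>a\<in>A. \<forall>a'\<in>A. (a, a') \<in> r1 \<longrightarrow> (\<phi> a, \<phi> a') \<in> r2) \<and>
     (\<forall>a\<in>A. \<forall>a'\<in>A. \<phi> a = \<phi> a' \<longrightarrow>
        (\<exists>v\<in>Field r1. a \<in> tower_pred r1 v \<and> a' \<in> tower_pred r1 v)) \<and>
     lower_set r2 (\<phi> ` A) \<and>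
     finite (\<phi> ` max_elems r1 A) \<and> card (\<phi> ` max_elems r1 A) \<le> 1"

end

theory Submission imports Defs begin

text \<open>
  An element of a tower with nonempty levels has exactly one element above it in each higher
  level (\<open>ex1_above_in_level\<close>): it has a common upper bound with an element of higher level, so it is never
  maximal, its least strict upper bound has level exactly one more
  (\<open>ex_successor\<close>), and the elements above it form a chain. The order is therefore the one
  generated by the level maps. The same
  lemma shows that a selection of levels \<open>\<alpha>\<close> gives again a tower whose \<open>n\<close>-th level is level
  \<open>\<alpha> n\<close> of the original one (\<open>tower_subtower\<close>, \<open>lev_subtower\<close>): an interval from a
  bottom element contains one element of each level in between, so its selected elements are
  counted by the selected indices.

  In these terms the map \<open>f\<close> preserves levels by construction. It is monotone because
  it commutes with the maps of the two subchains: following the zig-zag from \<open>level T (\<alpha> n)\<close> for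
  three steps is both \<open>f\<close> after the map of the \<open>\<alpha>\<close>-subchain and the map of the
  \<open>\<beta>\<close>-subchain after \<open>f\<close>. If \<open>f a = f b\<close>, then \<open>a\<close> and \<open>b\<close> lie in one level, and the
  next zig-zag map, from \<open>T'\<close> back to \<open>T\<close>, sends this common image to the successor of \<open>a\<close> and to
  that of \<open>b\<close>; so \<open>a\<close> and \<open>b\<close> are predecessors of one element. The maps of a \<open>D\<^sub>+\<close>-chain are
  surjective, hence so is \<open>f\<close>, and its image is trivially a lower set. Finally a tower of
  selected levels has no maximal elements.
\<close>

section \<open>Levels of a tower\<close>

locale tower_order =
  fixes r :: "'a rel"
  assumes is_tower: "tower r"
begin

lemma tower_refl: "x \<in> Field r \<Longrightarrow> (x, x) \<in> r"
  and tower_trans: "(x, y) \<in> r \<Longrightarrow> (y, z) \<in> r \<Longrightarrow> (x, z) \<in> r"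
  and tower_antisym: "(x, y) \<in> r \<Longrightarrow> (y, x) \<in> r \<Longrightarrow> x = y"
  using is_tower unfolding tower_def partial_order_on_def preorder_on_def
  by (meson refl_onD transD antisymD)+

lemma above_comparable: "(x, y) \<in> r \<Longrightarrow> (x, z) \<in> r \<Longrightarrow> (y, z) \<in> r \<or> (z, y) \<in> r"
proof -
  assume xy: "(x, y) \<in> r" and xz: "(x, z) \<in> r"
  then have "total_on (above r x) r"
    using is_tower unfolding tower_def by (blast intro: FieldI1)
  then show ?thesis
    using xy xz tower_refl[of y] by (auto simp: total_on_def above_def intro: FieldI2)
qed

lemma ex_sup:
  "x \<in> Field r \<Longrightarrow> y \<in> Field r \<Longrightarrow>
    \<exists>z. (x, z) \<in> r \<and> (y, z) \<in> r \<and> (\<forall>w. (x, w) \<in> r \<and> (y, w) \<in> r \<longrightarrow> (z, w) \<in> r)"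
  using is_tower unfolding tower_def by blast

lemma ex_minimal:
  assumes "S \<subseteq> Field r" "S \<noteq> {}"
  obtains m where "m \<in> S" "\<And>y. y \<in> S \<Longrightarrow> (y, m) \<in> r \<Longrightarrow> y = m"
proof -
  have "min_elems r S \<noteq> {}" using assms is_tower by (simp add: tower_def)
  then show thesis using that by (auto simp: min_elems_def)
qed

lemma ex_minimal_below:
  assumes "a \<in> Field r"
  obtains x where "x \<in> min_elems r (Field r)" "(x, a) \<in> r"
proof -
  have "under r a \<subseteq> Field r" "under r a \<noteq> {}"
    using assms tower_refl by (auto simp: under_def intro: FieldI1)
  then obtain x where x: "x \<in> under r a" "\<And>y. y \<in> under r a \<Longrightarrow> (y, x) \<in> r \<Longrightarrow> y = x"
    by (rule ex_minimal) blast
  then have "x \<in> min_elems r (Field r)"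
    using tower_trans by (auto simp: min_elems_def under_def intro: FieldI1)
  moreover have "(x, a) \<in> r" using x(1) by (simp add: under_def)
  ultimately show thesis by (rule that)
qed

text \<open>A level can be computed from any one bottom element, because a tower assigns the same count
  to all of them.\<close>

lemma finite_interval_and_lev:
  assumes "x \<in> min_elems r (Field r)" "(x, a) \<in> r"
  shows "finite (above r x \<inter> under r a)" "lev r a = card (above r x \<inter> under r a)"
proof -
  have a: "a \<in> Field r" using assms by (auto intro: FieldI2)
  have x: "x \<in> min_elems r (Field r) \<inter> under r a" using assms by (auto simp: under_def)
  obtain n where n: "\<forall>x\<in>min_elems r (Field r) \<inter> under r a.
        finite (above r x \<inter> under r a) \<and> card (above r x \<inter> under r a) = n"
    using is_tower a unfolding tower_def by blast
  then have "lev r a = n"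
    unfolding lev_def using x by (intro the_equality) auto
  then show "finite (above r x \<inter> under r a)" "lev r a = card (above r x \<inter> under r a)"
    using n x by auto
qed

text \<open>Both levels can be counted from a bottom element below \<open>a\<close>; the interval up to \<open>b\<close>
  contains the one up to \<open>a\<close> and has the additional element \<open>b\<close>.\<close>

lemma lev_strict_mono:
  assumes "(a, b) \<in> r" "a \<noteq> b"
  shows "lev r a < lev r b"
proof -
  have "a \<in> Field r" using assms by (auto intro: FieldI1)
  then obtain x where x: "x \<in> min_elems r (Field r)" "(x, a) \<in> r" by (rule ex_minimal_below)
  have xb: "(x, b) \<in> r" using x assms tower_trans by blast
  have "b \<in> above r x \<inter> under r b" "b \<notin> above r x \<inter> under r a"
    using xb assms tower_antisym tower_refl by (auto simp: above_def under_def intro: FieldI2)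
  moreover have "above r x \<inter> under r a \<subseteq> above r x \<inter> under r b"
    using assms tower_trans by (auto simp: under_def)
  ultimately have "above r x \<inter> under r a \<subset> above r x \<inter> under r b" by blast
  from psubset_card_mono[OF finite_interval_and_lev(1)[OF x(1) xb] this] show ?thesis
    unfolding finite_interval_and_lev(2)[OF x] finite_interval_and_lev(2)[OF x(1) xb] .
qed

lemma lev_mono: "(a, b) \<in> r \<Longrightarrow> lev r a \<le> lev r b"
  using lev_strict_mono[of a b] by (cases "a = b") simp_all

lemma lev_minimal: "x \<in> min_elems r (Field r) \<Longrightarrow> lev r x = 1"
proof -
  assume x: "x \<in> min_elems r (Field r)"
  then have xx: "(x, x) \<in> r" by (simp add: min_elems_def tower_refl)
  then have "above r x \<inter> under r x = {x}"
    using tower_antisym by (auto simp: above_def under_def)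
  then show ?thesis using finite_interval_and_lev(2)[OF x xx] by simp
qed

lemma lev_positive:
  assumes "a \<in> Field r"
  shows "1 \<le> lev r a"
proof -
  obtain x where "x \<in> min_elems r (Field r)" "(x, a) \<in> r"
    using assms by (rule ex_minimal_below)
  then show ?thesis using lev_mono[of x a] lev_minimal[of x] by simp
qed

text \<open>Elements with a common lower bound are comparable, and \<open>lev\<close> is strictly monotone, so the
  order among them can be read off from the levels.\<close>

lemma above_le_by_lev:
  assumes "(x, y) \<in> r" "(x, z) \<in> r" "lev r y \<le> lev r z"
  shows "(y, z) \<in> r"
  using above_comparable[OF assms(1,2)] lev_strict_mono[of z y] assms(3) by (cases "y = z") auto

lemma ex_least_in_upper_part:
  assumes "S \<subseteq> above r x" "S \<noteq> {}"
  obtains m where "m \<in> S" "\<And>y. y \<in> S \<Longrightarrow> (m, y) \<in> r"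
proof -
  have "S \<subseteq> Field r" using assms by (auto simp: above_def intro: FieldI2)
  then obtain m where m: "m \<in> S" "\<And>y. y \<in> S \<Longrightarrow> (y, m) \<in> r \<Longrightarrow> y = m"
    using assms(2) by (rule ex_minimal) blast
  have "(m, y) \<in> r" if "y \<in> S" for y
  proof -
    have "(x, m) \<in> r" "(x, y) \<in> r" using assms m that by (auto simp: above_def)
    then show ?thesis using above_comparable m that by metis
  qed
  with m show thesis using that by blast
qed

text \<open>The successor is the least strict upper bound \<open>c\<close>. Every element between a bottom
  element and \<open>c\<close> is comparable with \<open>a\<close>, hence is \<open>c\<close> itself or lies below \<open>a\<close>, so the interval
  grows by the single element \<open>c\<close>.\<close>

lemma ex_successor:
  assumes "(a, b) \<in> r" "a \<noteq> b"
  obtains c where "(a, c) \<in> r" "lev r c = lev r a + 1"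
proof -
  let ?S = "above r a - {a}"
  have "?S \<subseteq> above r a" "?S \<noteq> {}" using assms by (auto simp: above_def)
  then obtain c where c: "c \<in> ?S" "\<And>y. y \<in> ?S \<Longrightarrow> (c, y) \<in> r"
    by (rule ex_least_in_upper_part) blast
  then have ac: "(a, c) \<in> r" "a \<noteq> c" by (auto simp: above_def)
  have "a \<in> Field r" using assms by (auto intro: FieldI1)
  then obtain x where x: "x \<in> min_elems r (Field r)" "(x, a) \<in> r" by (rule ex_minimal_below)
  have xc: "(x, c) \<in> r" using x ac tower_trans by blast
  have "y = c \<or> (y, a) \<in> r" if "(x, y) \<in> r" "(y, c) \<in> r" for y
    using above_comparable[OF that(1) x(2)] c(2)[of y] that(2) tower_antisym
    by (cases "y = a") (auto simp: above_def)
  then have "above r x \<inter> under r c = insert c (above r x \<inter> under r a)"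
    using xc ac tower_trans tower_refl[of c] by (auto simp: above_def under_def intro: FieldI2)
  moreover have "c \<notin> above r x \<inter> under r a"
    using ac tower_antisym by (auto simp: under_def)
  ultimately have "lev r c = lev r a + 1"
    using finite_interval_and_lev[OF x] finite_interval_and_lev(2)[OF x(1) xc] by simp
  with ac show thesis using that by blast
qed

end

locale unbounded_tower = tower_order +
  assumes level_nonempty: "n \<ge> 1 \<Longrightarrow> level r n \<noteq> {}"
begin

text \<open>No element is maximal: a common upper bound with an element of the next level cannot be the
  element itself.\<close>

lemma ex_above_in_next_level:
  assumes "a \<in> Field r"
  obtains c where "(a, c) \<in> r" "lev r c = lev r a + 1"
proof -
  obtain w where w: "w \<in> Field r" "lev r w = lev r a + 1"
    using level_nonempty[of "lev r a + 1"] by (auto simp: level_def)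
  obtain z where z: "(a, z) \<in> r" "(w, z) \<in> r" using ex_sup[OF assms w(1)] by blast
  have "a \<noteq> z" using lev_mono[OF z(2)] w by auto
  with z(1) show thesis using that by (rule ex_successor)
qed

lemma ex1_above_in_level:
  assumes "a \<in> Field r" "lev r a \<le> k"
  shows "\<exists>!y. y \<in> level r k \<and> (a, y) \<in> r"
proof -
  have "\<exists>y. y \<in> level r k \<and> (a, y) \<in> r"
    using assms(2)
  proof (induction k rule: dec_induct)
    case base
    then show ?case using assms(1) tower_refl by (auto simp: level_def)
  next
    case (step k)
    then obtain y where y: "y \<in> level r k" "(a, y) \<in> r" by blast
    then obtain c where "(y, c) \<in> r" "lev r c = lev r y + 1"
      using ex_above_in_next_level[of y] by (auto simp: level_def)
    then show ?case
      using y tower_trans[of a y c] by (intro exI[of _ c]) (simp add: level_def FieldI2)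
  qed
  moreover have "y = z" if "y \<in> level r k \<and> (a, y) \<in> r" "z \<in> level r k \<and> (a, z) \<in> r" for y z
    using that above_le_by_lev[of a y z] above_le_by_lev[of a z y] tower_antisym
    by (simp add: level_def)
  ultimately show ?thesis by blast
qed

text \<open>Going up from a bottom element below \<open>a\<close> one meets level \<open>k\<close>; the element found there is
  comparable with \<open>a\<close> and hence below it.\<close>

lemma ex_below_in_level:
  assumes "a \<in> Field r" "1 \<le> k" "k \<le> lev r a"
  obtains b where "b \<in> level r k" "(b, a) \<in> r"
proof -
  obtain x where x: "x \<in> min_elems r (Field r)" "(x, a) \<in> r"
    using assms(1) by (rule ex_minimal_below)
  then have "x \<in> Field r" "lev r x \<le> k" using lev_minimal assms by (auto intro: FieldI1)
  then obtain b where b: "b \<in> level r k" "(x, b) \<in> r" using ex1_above_in_level by blast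
  then have "(b, a) \<in> r"
    using above_le_by_lev[OF b(2) x(2)] assms(3) by (simp add: level_def)
  with b(1) show thesis by (rule that)
qed

lemma bij_betw_lev_interval:
  assumes "(x, a) \<in> r"
  shows "bij_betw (lev r) (above r x \<inter> under r a) {lev r x..lev r a}"
  unfolding bij_betw_def
proof (intro conjI)
  show "inj_on (lev r) (above r x \<inter> under r a)"
  proof (rule inj_onI)
    fix y z assume "y \<in> above r x \<inter> under r a" "z \<in> above r x \<inter> under r a" "lev r y = lev r z"
    then show "y = z"
      using above_le_by_lev[of x y z] above_le_by_lev[of x z y] tower_antisym[of y z]
      by (simp add: above_def)
  qed
  have "k \<in> lev r ` (above r x \<inter> under r a)" if k: "lev r x \<le> k" "k \<le> lev r a" for k
  proof -
    obtain y where y: "y \<in> level r k" "(x, y) \<in> r"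
      using ex1_above_in_level[of x k] k(1) assms by (blast intro: FieldI1)
    then have "(y, a) \<in> r"
      using above_le_by_lev[OF y(2) assms] k(2) by (simp add: level_def)
    with y show ?thesis
      by (intro image_eqI[of _ _ y]) (simp_all add: level_def above_def under_def)
  qed
  then show "lev r ` (above r x \<inter> under r a) = {lev r x..lev r a}"
    by (auto simp: above_def under_def lev_mono)
qed

lemma level_map_above:
  assumes "a \<in> level r k"
  shows "level_map r k a \<in> level r (k + 1)" "(a, level_map r k a) \<in> r"
proof -
  have "\<exists>!y. y \<in> level r (k + 1) \<and> (a, y) \<in> r"
    using assms ex1_above_in_level[of a "k + 1"] by (simp add: level_def)
  from theI'[OF this] show "level_map r k a \<in> level r (k + 1)" "(a, level_map r k a) \<in> r"
    by (simp_all add: level_map_def)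
qed

lemma fold_level_map_above:
  assumes "a \<in> level r m" "m \<le> k"
  shows "fold (level_map r) [m..<k] a \<in> level r k \<and> (a, fold (level_map r) [m..<k] a) \<in> r"
  using assms(2)
proof (induction k rule: dec_induct)
  case base
  then show ?case using assms tower_refl by (simp add: level_def)
next
  case (step k)
  let ?y = "fold (level_map r) [m..<k] a"
  have "level_map r k ?y \<in> level r (k + 1)" "(?y, level_map r k ?y) \<in> r"
    using step.IH level_map_above by blast+
  moreover have "fold (level_map r) [m..<Suc k] a = level_map r k ?y"
    using step.hyps by simp
  ultimately show ?case using step.IH tower_trans[of a ?y "level_map r k ?y"] by simp
qed

end

section \<open>Towers made of selected levels\<close>

locale level_selection = unbounded_tower +
  fixes \<alpha> :: "nat \<Rightarrow> nat"
  assumes \<alpha>_increasing: "increasing \<alpha>"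
begin

abbreviation selected :: "'a set" where
  "selected \<equiv> \<Union>n\<in>{1..}. level r (\<alpha> n)"

lemma \<alpha>_ge_1: "n \<ge> 1 \<Longrightarrow> 1 \<le> \<alpha> n"
  and \<alpha>_less: "1 \<le> m \<Longrightarrow> m < n \<Longrightarrow> \<alpha> m < \<alpha> n"
  using \<alpha>_increasing by (auto simp: increasing_def strict_mono_on_def)

lemma \<alpha>_le_iff: "1 \<le> m \<Longrightarrow> 1 \<le> n \<Longrightarrow> \<alpha> m \<le> \<alpha> n \<longleftrightarrow> m \<le> n"
  using \<alpha>_less[of m n] \<alpha>_less[of n m] by (metis le_less not_le)

lemma \<alpha>_inj_on: "inj_on \<alpha> {1..n}"
  by (rule inj_onI) (metis \<alpha>_le_iff atLeastAtMost_iff order.antisym order.refl)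

lemma le_\<alpha>: "n \<ge> 1 \<Longrightarrow> n \<le> \<alpha> n"
proof (induction n rule: dec_induct)
  case base
  then show ?case using \<alpha>_ge_1 by simp
next
  case (step n)
  then show ?case using \<alpha>_less[of n "Suc n"] by simp
qed

lemma subtower_iff: "(x, y) \<in> subtower r \<alpha> \<longleftrightarrow> (x, y) \<in> r \<and> x \<in> selected \<and> y \<in> selected"
  by (auto simp: subtower_def)

lemma Field_subtower: "Field (subtower r \<alpha>) = selected"
proof
  show "Field (subtower r \<alpha>) \<subseteq> selected"
    unfolding Field_def using subtower_iff by blast
  show "selected \<subseteq> Field (subtower r \<alpha>)"
  proof
    fix x assume x: "x \<in> selected"
    then have "(x, x) \<in> r" using tower_refl by (auto simp: level_def)
    with x have "(x, x) \<in> subtower r \<alpha>" by (simp add: subtower_iff)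
    then show "x \<in> Field (subtower r \<alpha>)" by (rule FieldI1)
  qed
qed

text \<open>A minimal selected element \<open>x\<close> has level \<open>\<alpha> 1\<close> in the big tower, since otherwise some
  element of level \<open>\<alpha> 1\<close> would be strictly below it. On the interval from \<open>x\<close> to \<open>a\<close> the level is a
  bijection onto \<open>{\<alpha> 1..\<alpha> n}\<close>, and the selected elements are those with level in
  \<open>\<alpha> ` {1..n}\<close>.\<close>

lemma card_subtower_interval:
  assumes "n \<ge> 1" "a \<in> level r (\<alpha> n)"
    and x: "x \<in> min_elems (subtower r \<alpha>) selected" "(x, a) \<in> subtower r \<alpha>"
  defines "I \<equiv> above (subtower r \<alpha>) x \<inter> under (subtower r \<alpha>) a"
  shows "finite I" "card I = n"
proof -
  have xa: "(x, a) \<in> r" and xsel: "x \<in> selected" and a: "a \<in> selected"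
    using x by (auto simp: subtower_iff)
  have lev_a: "lev r a = \<alpha> n" using assms by (simp add: level_def)
  have lev_x: "lev r x = \<alpha> 1"
  proof -
    have "x \<in> Field r" "\<alpha> 1 \<le> lev r x"
      using xsel \<alpha>_le_iff by (auto simp: level_def)
    then obtain b where b: "b \<in> level r (\<alpha> 1)" "(b, x) \<in> r"
      using ex_below_in_level \<alpha>_ge_1[of 1] by auto
    then have "b = x"
      using x xsel by (auto simp: min_elems_def subtower_iff)
    then show ?thesis using b by (simp add: level_def)
  qed
  have bij: "bij_betw (lev r) (above r x \<inter> under r a) {\<alpha> 1..\<alpha> n}"
    using bij_betw_lev_interval[OF xa] lev_x lev_a by simp
  have I: "I = {y \<in> above r x \<inter> under r a. \<exists>m\<ge>1. lev r y = \<alpha> m}"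
    using xsel a
    by (auto simp: I_def above_def under_def subtower_iff level_def intro: FieldI2)
  have "lev r ` I = \<alpha> ` {1..n}"
  proof
    show "lev r ` I \<subseteq> \<alpha> ` {1..n}"
    proof
      fix k assume "k \<in> lev r ` I"
      then obtain y m where y: "y \<in> above r x \<inter> under r a" "m \<ge> 1" "k = lev r y" "k = \<alpha> m"
        using I by auto
      then have "\<alpha> m \<le> \<alpha> n" using lev_mono[of y a] lev_a by (simp add: under_def)
      then have "m \<le> n" using \<alpha>_le_iff y(2) assms(1) by blast
      then show "k \<in> \<alpha> ` {1..n}" using y(2,4) by auto
    qed
    show "\<alpha> ` {1..n} \<subseteq> lev r ` I"
    proof
      fix k assume "k \<in> \<alpha> ` {1..n}"
      then obtain m where m: "1 \<le> m" "m \<le> n" "k = \<alpha> m" by auto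
      then have "k \<in> {\<alpha> 1..\<alpha> n}" using \<alpha>_le_iff by auto
      then obtain y where "y \<in> above r x \<inter> under r a" "lev r y = k"
        using bij by (metis bij_betw_imp_surj_on imageE)
      then show "k \<in> lev r ` I" using I m by blast
    qed
  qed
  moreover have "inj_on (lev r) I"
    using bij I by (auto simp: bij_betw_def inj_on_def)
  ultimately have "bij_betw (lev r) I (\<alpha> ` {1..n})" by (simp add: bij_betw_def)
  then show "finite I" "card I = n"
    using bij_betw_finite bij_betw_same_card card_image[OF \<alpha>_inj_on] by fastforce+
qed

text \<open>The supremum in the big tower need not be selected. But some selected element lies above
  it, so the selected common upper bounds form a nonempty part of the chain above \<open>x\<close>, and
  their least element is the supremum among the selected elements.\<close>

lemma subtower_ex_sup:
  assumes "x \<in> selected" "y \<in> selected"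
  shows "\<exists>z. (x, z) \<in> subtower r \<alpha> \<and> (y, z) \<in> subtower r \<alpha> \<and>
    (\<forall>w. (x, w) \<in> subtower r \<alpha> \<and> (y, w) \<in> subtower r \<alpha> \<longrightarrow> (z, w) \<in> subtower r \<alpha>)"
proof -
  let ?U = "{w \<in> selected. (x, w) \<in> r \<and> (y, w) \<in> r}"
  have "x \<in> Field r" "y \<in> Field r" using assms by (auto simp: level_def)
  then obtain u where u: "(x, u) \<in> r" "(y, u) \<in> r" using ex_sup by blast
  then have uF: "u \<in> Field r" by (auto intro: FieldI2)
  \<comment> \<open>As \<open>n \<le> \<alpha> n\<close>, the level of \<open>u\<close> itself serves as the index of a selected level above \<open>u\<close>.\<close>
  then have "lev r u \<le> \<alpha> (lev r u)" using le_\<alpha> lev_positive by blast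
  then obtain w where w: "w \<in> level r (\<alpha> (lev r u))" "(u, w) \<in> r"
    using ex1_above_in_level uF by blast
  have "w \<in> ?U" using w u lev_positive[OF uF] tower_trans by blast
  then have nonempty: "?U \<noteq> {}" by blast
  have "?U \<subseteq> above r x" by (auto simp: above_def)
  then obtain z where z: "z \<in> ?U" "\<And>w. w \<in> ?U \<Longrightarrow> (z, w) \<in> r"
    using nonempty by (rule ex_least_in_upper_part) blast
  then have "(z, w) \<in> subtower r \<alpha>"
    if "(x, w) \<in> subtower r \<alpha>" "(y, w) \<in> subtower r \<alpha>" for w
    using that unfolding subtower_iff by blast
  moreover have "(x, z) \<in> subtower r \<alpha>" "(y, z) \<in> subtower r \<alpha>"
    using z(1) assms by (simp_all add: subtower_iff)
  ultimately show ?thesis by blast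
qed

lemma tower_subtower: "tower (subtower r \<alpha>)"
  unfolding tower_def
proof (intro conjI)
  have sel: "selected \<subseteq> Field r" by (auto simp: level_def)
  show "Partial_order (subtower r \<alpha>)"
    unfolding partial_order_on_def preorder_on_def Field_subtower
  proof (intro conjI)
    show "refl_on selected (subtower r \<alpha>)"
      using sel tower_refl by (auto simp: refl_on_def subtower_iff level_def)
    show "trans (subtower r \<alpha>)"
      by (rule transI) (meson subtower_iff tower_trans)
    show "antisym (subtower r \<alpha>)"
      by (rule antisymI) (meson subtower_iff tower_antisym)
    show "subtower r \<alpha> \<subseteq> selected \<times> selected"
      using subtower_iff by auto
  qed
  show "\<forall>S. S \<subseteq> Field (subtower r \<alpha>) \<and> S \<noteq> {} \<longrightarrow> min_elems (subtower r \<alpha>) S \<noteq> {}"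
  proof (intro allI impI, elim conjE)
    fix S assume S: "S \<subseteq> Field (subtower r \<alpha>)" "S \<noteq> {}"
    then have "S \<subseteq> Field r" using sel Field_subtower by blast
    then obtain m where "m \<in> S" "\<And>y. y \<in> S \<Longrightarrow> (y, m) \<in> r \<Longrightarrow> y = m"
      using S(2) by (rule ex_minimal) blast
    then have "m \<in> min_elems (subtower r \<alpha>) S" by (simp add: min_elems_def subtower_iff)
    then show "min_elems (subtower r \<alpha>) S \<noteq> {}" by blast
  qed
  show "\<forall>x\<in>Field (subtower r \<alpha>). \<forall>y\<in>Field (subtower r \<alpha>). \<exists>z.
      (x, z) \<in> subtower r \<alpha> \<and> (y, z) \<in> subtower r \<alpha> \<and>
      (\<forall>w. (x, w) \<in> subtower r \<alpha> \<and> (y, w) \<in> subtower r \<alpha> \<longrightarrow> (z, w) \<in> subtower r \<alpha>)"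
    using subtower_ex_sup unfolding Field_subtower by blast
  show "\<forall>x\<in>Field (subtower r \<alpha>). total_on (above (subtower r \<alpha>) x) (subtower r \<alpha>)"
    using above_comparable unfolding total_on_def above_def subtower_iff by blast
  show "\<forall>a\<in>Field (subtower r \<alpha>). \<exists>n.
      \<forall>x\<in>min_elems (subtower r \<alpha>) (Field (subtower r \<alpha>)) \<inter> under (subtower r \<alpha>) a.
        finite (above (subtower r \<alpha>) x \<inter> under (subtower r \<alpha>) a) \<and>
        card (above (subtower r \<alpha>) x \<inter> under (subtower r \<alpha>) a) = n"
  proof
    fix a assume "a \<in> Field (subtower r \<alpha>)"
    then obtain n where n: "n \<ge> 1" "a \<in> level r (\<alpha> n)" unfolding Field_subtower by auto
    show "\<exists>n. \<forall>x\<in>min_elems (subtower r \<alpha>) (Field (subtower r \<alpha>)) \<inter> under (subtower r \<alpha>) a.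
        finite (above (subtower r \<alpha>) x \<inter> under (subtower r \<alpha>) a) \<and>
        card (above (subtower r \<alpha>) x \<inter> under (subtower r \<alpha>) a) = n"
      using card_subtower_interval[OF n] unfolding Field_subtower
      by (intro exI[of _ n]) (auto simp: under_def)
  qed
qed

sublocale sub: tower_order "subtower r \<alpha>"
  by unfold_locales (rule tower_subtower)

lemma lev_subtower:
  assumes "n \<ge> 1" "a \<in> level r (\<alpha> n)"
  shows "lev (subtower r \<alpha>) a = n"
proof -
  have "a \<in> Field (subtower r \<alpha>)" using assms Field_subtower by auto
  then obtain x where
    x: "x \<in> min_elems (subtower r \<alpha>) (Field (subtower r \<alpha>))" "(x, a) \<in> subtower r \<alpha>"
    by (rule sub.ex_minimal_below)
  then show ?thesis
    using sub.finite_interval_and_lev(2)[OF x] card_subtower_interval(2)[OF assms]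
    by (simp add: Field_subtower)
qed

lemma subchain_map_above:
  assumes "n \<ge> 1" "a \<in> level r (\<alpha> n)"
  shows "subchain_map (level_map r) \<alpha> n a \<in> level r (\<alpha> (n + 1))"
    and "(a, subchain_map (level_map r) \<alpha> n a) \<in> subtower r \<alpha>"
proof -
  have *: "subchain_map (level_map r) \<alpha> n a \<in> level r (\<alpha> (n + 1)) \<and>
      (a, subchain_map (level_map r) \<alpha> n a) \<in> r"
    unfolding subchain_map_def
    using fold_level_map_above[OF assms(2), of "\<alpha> (n + 1)"] \<alpha>_less[of n "n + 1"] assms(1) by auto
  then show "subchain_map (level_map r) \<alpha> n a \<in> level r (\<alpha> (n + 1))" by blast
  have "a \<in> selected" using assms by auto
  moreover have "subchain_map (level_map r) \<alpha> n a \<in> selected"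
    using * by (intro UN_I[of "n + 1"]) auto
  ultimately show "(a, subchain_map (level_map r) \<alpha> n a) \<in> subtower r \<alpha>"
    using * by (simp add: subtower_iff)
qed

lemma max_elems_subtower: "max_elems (subtower r \<alpha>) (Field (subtower r \<alpha>)) = {}"
proof -
  have "a \<notin> max_elems (subtower r \<alpha>) selected" if "n \<ge> 1" "a \<in> level r (\<alpha> n)" for a n
  proof
    let ?b = "subchain_map (level_map r) \<alpha> n a"
    assume "a \<in> max_elems (subtower r \<alpha>) selected"
    then have "?b = a"
      using subchain_map_above(2)[OF that] by (auto simp: max_elems_def subtower_iff)
    then show False
      using subchain_map_above(1)[OF that] that \<alpha>_less[of n "n + 1"] by (auto simp: level_def)
  qed
  then show ?thesis unfolding Field_subtower max_elems_def by blast
qed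

text \<open>The inductive step for statements about arbitrary pairs \<open>a \<le> b\<close>: a strict inequality
  factors through the image of \<open>a\<close> in the next selected level.\<close>

lemma above_next_selected:
  assumes "n \<ge> 1" "n < m" "a \<in> level r (\<alpha> n)" "b \<in> level r (\<alpha> m)" "(a, b) \<in> subtower r \<alpha>"
  shows "(subchain_map (level_map r) \<alpha> n a, b) \<in> subtower r \<alpha>"
proof -
  let ?c = "subchain_map (level_map r) \<alpha> n a"
  have "lev (subtower r \<alpha>) ?c = n + 1"
    using lev_subtower[of "n + 1" ?c] subchain_map_above(1)[of n a] assms by simp
  moreover have "lev (subtower r \<alpha>) b = m" using lev_subtower[of m b] assms by simp
  ultimately show ?thesis
    using sub.above_le_by_lev[OF subchain_map_above(2)[OF assms(1,3)] assms(5)] assms(2) by simp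
qed

end

section \<open>The map induced by a zig-zag chain\<close>

theorem proposition6p4:
  fixes T :: "'a rel" and T' :: "'b rel"
    and Z :: "nat \<Rightarrow> ('a + 'b) set" and V :: "nat \<Rightarrow> 'a + 'b \<Rightarrow> 'a + 'b"
    and \<alpha> \<beta> :: "nat \<Rightarrow> nat" and f :: "'a \<Rightarrow> 'b"
  assumes "tower T" and "tower T'"
    and "\<And>n. n \<ge> 1 \<Longrightarrow> level T n \<noteq> {}" and "\<And>n. n \<ge> 1 \<Longrightarrow> level T' n \<noteq> {}"
    and "zigzag_chain (level T) (level_map T) (level T') (level_map T') Z V \<alpha> \<beta>"
    and "\<And>n x. n \<ge> 1 \<Longrightarrow> x \<in> level T (\<alpha> n) \<Longrightarrow> Inr (f x) = V (2 * n - 1) (Inl x)"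
  shows "admissible_morphism (subtower T \<alpha>) (Field (subtower T \<alpha>)) (subtower T' \<beta>) f"
proof -
  have V_image: "V k ` Z k = Z (k + 1)" if "k \<ge> 1" for k
    using assms(5) that by (simp add: zigzag_chain_def D_plus_chain_def)
  have incr: "increasing \<alpha>" "increasing \<beta>"
    and Z_odd: "\<And>n. n \<ge> 1 \<Longrightarrow> Z (2 * n - 1) = Inl ` level T (\<alpha> n)"
    and Z_even: "\<And>n. n \<ge> 1 \<Longrightarrow> Z (2 * n) = Inr ` level T' (\<beta> n)"
    and V_X: "\<And>n x. n \<ge> 1 \<Longrightarrow> x \<in> level T (\<alpha> n) \<Longrightarrow>
      V (2 * n) (V (2 * n - 1) (Inl x)) = Inl (subchain_map (level_map T) \<alpha> n x)"
    and V_Y: "\<And>n y. n \<ge> 1 \<Longrightarrow> y \<in> level T' (\<beta> n) \<Longrightarrow>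
      V (2 * n + 1) (V (2 * n) (Inr y)) = Inr (subchain_map (level_map T') \<beta> n y)"
    using assms(5) by (simp_all add: zigzag_chain_def)
  note f = assms(6)
  interpret X: level_selection T \<alpha>
    using assms(1,3) incr by unfold_locales auto
  interpret Y: level_selection T' \<beta>
    using assms(2,4) incr by unfold_locales auto
  let ?up = "subchain_map (level_map T) \<alpha>" and ?up' = "subchain_map (level_map T') \<beta>"

  have f_level: "f ` level T (\<alpha> n) = level T' (\<beta> n)" if "n \<ge> 1" for n
  proof -
    have "Inr ` f ` level T (\<alpha> n) = V (2 * n - 1) ` Inl ` level T (\<alpha> n)"
      using f[OF that] by (auto simp: image_image intro!: image_cong)
    also have "\<dots> = V (2 * n - 1) ` Z (2 * n - 1)" using Z_odd that by simp
    also have "\<dots> = Z (2 * n - 1 + 1)" using V_image that by simp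
    also have "\<dots> = Inr ` level T' (\<beta> n)" using Z_even that by simp
    finally show ?thesis by (simp add: inj_image_eq_iff)
  qed
  have V_f: "V (2 * n) (Inr (f a)) = Inl (?up n a)" if "n \<ge> 1" "a \<in> level T (\<alpha> n)" for n a
    using V_X[OF that] f[OF that] by simp
  (* Both sides are three consecutive zig-zag maps applied to a. *)
  have f_up: "f (?up n a) = ?up' n (f a)" if n: "n \<ge> 1" and a: "a \<in> level T (\<alpha> n)" for n a
  proof -
    have "Inr (f (?up n a)) = V (2 * (n + 1) - 1) (Inl (?up n a))"
      using X.subchain_map_above(1)[OF n a] by (intro f) auto
    also have "\<dots> = V (2 * n + 1) (V (2 * n) (Inr (f a)))" using V_f[OF n a] by simp
    also have "\<dots> = Inr (?up' n (f a))" using V_Y[OF n] a f_level[OF n] by blast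
    finally show ?thesis by simp
  qed
  (* Induction on the number of selected levels between a and b, moving a up by one at a time. *)
  have f_mono: "(f a, f b) \<in> subtower T' \<beta>"
    if "n \<ge> 1" "a \<in> level T (\<alpha> n)" "b \<in> level T (\<alpha> (n + d))" "(a, b) \<in> subtower T \<alpha>" for n d a b
    using that
  proof (induction d arbitrary: n a)
    case 0
    then have "lev (subtower T \<alpha>) a = lev (subtower T \<alpha>) b"
      using X.lev_subtower[of n] by simp
    then have "a = b" using X.sub.lev_strict_mono[of a b] 0 by auto
    moreover have "f a \<in> level T' (\<beta> n)" using f_level 0 by blast
    ultimately show ?case
      using Y.sub.tower_refl[of "f a"] Y.Field_subtower 0 by auto
  next
    case (Suc d)
    have fa: "f a \<in> level T' (\<beta> n)" using f_level Suc.prems by blast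
    have "(?up n a, b) \<in> subtower T \<alpha>"
      using X.above_next_selected[of n "n + Suc d" a b] Suc.prems by simp
    then have "(f (?up n a), f b) \<in> subtower T' \<beta>"
      using Suc.IH[of "n + 1" "?up n a"] X.subchain_map_above(1)[of n a] Suc.prems by simp
    moreover have "(f a, f (?up n a)) \<in> subtower T' \<beta>"
      using f_up[of n a] Y.subchain_map_above(2)[of n "f a"] Suc.prems fa by simp
    ultimately show ?case by (rule Y.sub.tower_trans[rotated])
  qed
  have f_lev: "lev (subtower T' \<beta>) (f a) = n" if "n \<ge> 1" "a \<in> level T (\<alpha> n)" for n a
    using Y.lev_subtower[of n "f a"] f_level that by blast
  have image: "f ` Field (subtower T \<alpha>) = Field (subtower T' \<beta>)"
    unfolding X.Field_subtower Y.Field_subtower image_UN using f_level by simp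

  have lower: "lower_set s (Field s)" for s :: "'c rel"
    by (auto simp: lower_set_def under_def intro: FieldI1)
  show ?thesis
    unfolding admissible_morphism_def image X.max_elems_subtower
  proof (intro conjI ballI impI)
    show "lev (subtower T' \<beta>) (f a) = lev (subtower T \<alpha>) a" if "a \<in> Field (subtower T \<alpha>)" for a
      using that f_lev X.lev_subtower by (auto simp: X.Field_subtower)
    show "(f a, f b) \<in> subtower T' \<beta>"
      if ab: "a \<in> Field (subtower T \<alpha>)" "b \<in> Field (subtower T \<alpha>)" "(a, b) \<in> subtower T \<alpha>" for a b
    proof -
      obtain n m where nm: "n \<ge> 1" "a \<in> level T (\<alpha> n)" "m \<ge> 1" "b \<in> level T (\<alpha> m)"
        using ab(1,2) unfolding X.Field_subtower by auto
      then have "n \<le> m" using X.sub.lev_mono[OF ab(3)] X.lev_subtower by simp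
      then show ?thesis using f_mono[of n a b "m - n"] nm ab(3) by simp
    qed
    show "\<exists>v\<in>Field (subtower T \<alpha>). a \<in> tower_pred (subtower T \<alpha>) v \<and> b \<in> tower_pred (subtower T \<alpha>) v"
      if ab: "a \<in> Field (subtower T \<alpha>)" "b \<in> Field (subtower T \<alpha>)" "f a = f b" for a b
    proof -
      obtain n m where nm: "n \<ge> 1" "a \<in> level T (\<alpha> n)" "m \<ge> 1" "b \<in> level T (\<alpha> m)"
        using ab(1,2) unfolding X.Field_subtower by auto
      then have "n = m" using f_lev ab(3) by metis
      then have b: "b \<in> level T (\<alpha> n)" using nm by simp
      have up: "?up n a = ?up n b" using V_f nm b ab(3) by (metis sum.inject(1))
      have pred: "c \<in> tower_pred (subtower T \<alpha>) (?up n c)" if c: "c \<in> level T (\<alpha> n)" for c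
      proof -
        have "lev (subtower T \<alpha>) (?up n c) = n + 1"
          using X.lev_subtower[of "n + 1"] X.subchain_map_above(1)[OF nm(1) c] by simp
        moreover have "lev (subtower T \<alpha>) c = n" using X.lev_subtower nm(1) c by blast
        moreover have "(c, ?up n c) \<in> subtower T \<alpha>"
          using X.subchain_map_above(2)[OF nm(1) c] .
        ultimately show ?thesis
          by (auto simp: tower_pred_def level_def under_def intro: FieldI1)
      qed
      have "?up n a \<in> Field (subtower T \<alpha>)"
        using X.subchain_map_above(2)[OF nm(1,2)] by (rule FieldI2)
      then show ?thesis using pred[OF nm(2)] pred[OF b] up by auto
    qed
  qed (simp_all add: lower X.tower_subtower Y.tower_subtower)
qed

end
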